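(* Consider the equation $$T_nT_{n+d}T_{n+2d}\cdots T_{n+rd}=m_1!\,m_2!\cdots m_k!$$ in positive integers $n,r,d,k$ with $n\geq 3$ and integers $2\leq m_1\leq m_2\leq\cdots\leq m_k$. This equation has only finitely many solutions; in particular, every solution satisfies $rd\leq 1439862$ and $n<719933$.
   Context: The Tribonacci numbers $\{T_n\}_{n\ge 0}$ are defined by $T_0=0$, $T_1=T_2=1$ and $T_{n+3}=T_{n+2}+T_{n+1}+T_n$ for $n\ge 0$. *)

theory Defs
  imports Complex_Main
begin

fun trib :: "nat \<Rightarrow> nat" where
  "trib 0 = 0"
| "trib (Suc 0) = 1"
| "trib (Suc (Suc 0)) = 1"
| "trib (Suc (Suc (Suc n))) = trib (Suc (Suc n)) + trib (Suc n) + trib n"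

(* The tuple m_1 <= ... <= m_k is the sorted list ms of length k. *)
definition trib_fact_solution :: "nat \<Rightarrow> nat \<Rightarrow> nat \<Rightarrow> nat \<Rightarrow> nat list \<Rightarrow> bool" where
  "trib_fact_solution n r d k ms \<longleftrightarrow>
     n \<ge> 3 \<and> r \<ge> 1 \<and> d \<ge> 1 \<and> k \<ge> 1 \<and>
     length ms = k \<and> sorted ms \<and> (\<forall>m\<in>set ms. 2 \<le> m) \<and>
     (\<Prod>i=0..r. trib (n + i * d)) = (\<Prod>j<k. fact (ms ! j))"

end

theory Submission
  imports Defs "HOL-Computational_Algebra.Primes"
begin

text \<open>
  The proof compares the size of both sides with their 2-adic valuation $v_2$.
  Write $N = n + rd$ for the largest index.

  Tribonacci numbers are barely divisible by 2: $2^{v_2(T_n)} \le 2n + 34$ for $n \ge 1$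
  (\<open>two_power_multiplicity_trib_le\<close>). Hence the left side, a product of $r+1$ Tribonacci
  numbers, has a valuation of order at most $(r+1) \log N$, although its logarithm is of order
  at least $(r+1) N$ (\<open>two_power_le_prod_trib\<close>). A product of factorials of valuation $V$
  involves only factorials of numbers $m \le 3V$, because $v_2(m!) \ge m/3$; so it is at most
  $(3V)^{3V}$ (\<open>prod_fact_le\<close>). As $r \le N$, taking logarithms shows that $N$ is at most of
  order $(\log N)^2$, with constants good enough to give $N < 8192$. Then all of $n$, $r$, $d$ are
  bounded, and the valuation bounds the $m_j$ and their number.

  The estimate for $v_2(T_n)$ rests on the Tribonacci sequence extended to negative indices. It
  vanishes at $0, -1, -4, -17$, and modulo $2^{k+1}$ it vanishes only at indices that are
  congruent to one of these modulo $2^k$, if $k \ge 5$ (\<open>dvd_btrib_imp_mod\<close>). A positive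
  index cannot be close 2-adically to one of $0, -1, -4, -17$ without being large. The
  induction on $k$ behind this needs to know how the sequence changes modulo $2^{k+2}$ under the
  shift by $2^k$ (\<open>btrib_add_two_power\<close>).
\<close>

section \<open>The two-sided Tribonacci sequence\<close>

definition trib_step :: "int \<times> int \<times> int \<Rightarrow> int \<times> int \<times> int" where
  "trib_step = (\<lambda>(x, y, z). (y, z, x + y + z))"

text \<open>
  The value at \<open>m\<close> is the Tribonacci number of index $m - 17$: the first three values are
  $T_{-17}$, $T_{-16}$, $T_{-15}$. Starting at $-17$ puts all zeros of the two-sided sequence
  that matter at natural numbers, namely $0, 13, 16, 17$. Iterating on triples makes the values
  computable in linear time.
\<close>
definition btrib :: "nat \<Rightarrow> int" where
  "btrib m = fst ((trib_step ^^ m) (0, 56, -47))"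

lemma funpow_trib_step:
  "(trib_step ^^ m) (0, 56, -47) = (btrib m, btrib (m + 1), btrib (m + 2))"
  by (simp add: btrib_def trib_step_def split_beta)

lemma btrib_rec: "btrib (m + 3) = btrib (m + 2) + btrib (m + 1) + btrib m"
proof -
  have "btrib (m + 3) = fst (trib_step (trib_step (trib_step ((trib_step ^^ m) (0, 56, -47)))))"
    by (simp add: btrib_def numeral_3_eq_3)
  then show ?thesis
    by (simp only: funpow_trib_step) (simp add: trib_step_def)
qed

lemma btrib_values:
  "btrib 0 = 0" "btrib 1 = 56" "btrib 2 = -47"
  "btrib 13 = 0" "btrib 14 = -1" "btrib 15 = 1"
  "btrib 16 = 0" "btrib 17 = 0" "btrib 18 = 1" "btrib 19 = 1"
  by code_simp+

lemma btrib_eq_trib: "btrib (n + 17) = int (trib n)"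
proof (induction n rule: trib.induct)
  case (4 n)
  then show ?case
    using btrib_rec[of "n + 17"] by (simp add: eval_nat_numeral)
qed (use btrib_values in \<open>simp_all add: eval_nat_numeral\<close>)

section \<open>The shift by a power of two\<close>

text \<open>
  The shift operator \<open>S\<close> satisfies $S^3 = S^2 + S + 1$ on the sequence, so every polynomial in
  \<open>S\<close> reduces to one of degree 2. The conclusion is the reduction of $(aS^2 + bS + c)^2$.
\<close>
lemma btrib_shift_double:
  assumes "\<And>m. btrib (m + p) = a * btrib (m + 2) + b * btrib (m + 1) + c * btrib m"
  shows "btrib (m + 2 * p) = (2*a\<^sup>2 + 2*a*b + b\<^sup>2 + 2*a*c) * btrib (m + 2)
           + (2*a\<^sup>2 + 2*a*b + 2*b*c) * btrib (m + 1) + (a\<^sup>2 + 2*a*b + c\<^sup>2) * btrib m"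
proof -
  have r3: "btrib (m + 3) = btrib (m + 2) + btrib (m + 1) + btrib m"
    by (rule btrib_rec)
  have r4: "btrib (m + 4) = btrib (m + 3) + btrib (m + 2) + btrib (m + 1)"
    using btrib_rec[of "m + 1"] by (simp add: add.commute add.left_commute eval_nat_numeral)
  have "btrib (m + 2 * p) = btrib ((m + p) + p)"
    by (simp add: mult_2 add.assoc)
  also have "\<dots> = a * btrib ((m + 2) + p) + b * btrib ((m + 1) + p) + c * btrib (m + p)"
    using assms[of "m + p"] by (simp add: ac_simps)
  also have "\<dots> = a * (a * btrib (m + 4) + b * btrib (m + 3) + c * btrib (m + 2))
      + b * (a * btrib (m + 3) + b * btrib (m + 2) + c * btrib (m + 1))
      + c * (a * btrib (m + 2) + b * btrib (m + 1) + c * btrib m)"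
    using assms[of "m + 2"] assms[of "m + 1"] assms[of m]
    by (simp add: eval_nat_numeral)
  finally show ?thesis
    by (simp add: r4 r3 algebra_simps power2_eq_square)
qed

lemma btrib_add_32:
  "btrib (m + 32) = 53798080 * btrib (m + 2) + 45152016 * btrib (m + 1) + 29249425 * btrib m"
proof -
  have 2: "btrib (m + 2) = 1 * btrib (m + 2) + 0 * btrib (m + 1) + 0 * btrib m" for m
    by simp
  have 4: "btrib (m + 4) = 2 * btrib (m + 2) + 2 * btrib (m + 1) + 1 * btrib m" for m
    using btrib_shift_double[OF 2] by simp
  have 8: "btrib (m + 8) = 24 * btrib (m + 2) + 20 * btrib (m + 1) + 13 * btrib m" for m
    using btrib_shift_double[OF 4] by simp
  have 16: "btrib (m + 16) = 3136 * btrib (m + 2) + 2632 * btrib (m + 1) + 1705 * btrib m" for m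
    using btrib_shift_double[OF 8] by simp
  show ?thesis
    using btrib_shift_double[OF 16] by simp
qed

text \<open>
  If $S^{2^k} = 1 + 2^{k-1} D$, then $S^{2^{k+1}} = 1 + 2^k (D + 2^{k-2} D^2)$, so that the
  coefficients of \<open>D\<close> modulo 8 do not change any more from $k = 5$ on. They have to be known
  modulo 8, since \<open>D\<close> will be evaluated at zeros where it is divisible by 4.
\<close>
lemma btrib_add_two_power:
  assumes "k \<ge> 5"
  shows "\<exists>a b c. a mod 8 = 4 \<and> b mod 8 = 1 \<and> c mod 8 = 1 \<and>
           (\<forall>m. btrib (m + 2 ^ k) =
              btrib m + 2 ^ (k - 1) * (a * btrib (m + 2) + b * btrib (m + 1) + c * btrib m))"
  using assms
proof (induction k rule: dec_induct)
  case base
  \<comment> \<open>the coefficients of \<open>btrib_add_32\<close>, after subtracting 1 from the last one, divided by 16\<close>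
  show ?case
    by (rule exI[of _ 3362380], rule exI[of _ 2822001], rule exI[of _ 1828089])
       (simp add: btrib_add_32)
next
  case (step k)
  then obtain a b c where abc: "a mod 8 = 4" "b mod 8 = 1" "c mod 8 = 1"
    and shift: "\<And>m. btrib (m + 2 ^ k) =
      btrib m + 2 ^ (k - 1) * (a * btrib (m + 2) + b * btrib (m + 1) + c * btrib m)"
    by blast
  define q :: int where "q = 2 ^ (k - 5)"
  obtain j where j: "k = j + 5"
    using step.hyps by (metis add.commute le_Suc_ex)
  have pow: "(2::int) ^ (k - 1) = 16 * q" "(2::int) ^ k = 32 * q"
    by (simp_all add: q_def j power_add)
  define a' where "a' = a + 8 * q * (2*a\<^sup>2 + 2*a*b + b\<^sup>2 + 2*a*c)"
  define b' where "b' = b + 8 * q * (2*a\<^sup>2 + 2*a*b + 2*b*c)"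
  define c' where "c' = c + 8 * q * (a\<^sup>2 + 2*a*b + c\<^sup>2)"
  have "btrib (m + 2 ^ Suc k) =
      btrib m + 2 ^ (Suc k - 1) * (a' * btrib (m + 2) + b' * btrib (m + 1) + c' * btrib m)" for m
  proof -
    have "btrib (m + 2 ^ k) = (16*q*a) * btrib (m + 2) + (16*q*b) * btrib (m + 1)
        + (1 + 16*q*c) * btrib m" for m
      unfolding shift pow by (simp add: algebra_simps)
    from btrib_shift_double[OF this, of m] show ?thesis
      by (simp add: pow a'_def b'_def c'_def algebra_simps power2_eq_square)
  qed
  moreover have "a' mod 8 = 4" "b' mod 8 = 1" "c' mod 8 = 1"
    using abc by (simp_all add: a'_def b'_def c'_def mod_add_eq[symmetric] mult.assoc)
  ultimately show ?case
    by blast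
qed

section \<open>The 2-adic valuation of Tribonacci numbers\<close>

text \<open>
  Each shift by $2^k$ adds $2^{k-1}$ times a combination of three consecutive values. These values
  themselves only change by multiples of 16, so modulo 8 the combination is the same for all
  \<open>s\<close> shifts, and the increments add up.
\<close>
lemma btrib_add_mult_two_power:
  assumes "k \<ge> 5"
  shows "\<exists>e. btrib (m + s * 2 ^ k) =
    btrib m + 2 ^ (k - 1) * (int s * (4 * btrib (m + 2) + btrib (m + 1) + btrib m) + 8 * e)"
proof -
  from btrib_add_two_power[OF assms] obtain a b c
    where abc: "a mod 8 = 4" "b mod 8 = 1" "c mod 8 = 1"
    and shift: "\<And>m. btrib (m + 2 ^ k) =
      btrib m + 2 ^ (k - 1) * (a * btrib (m + 2) + b * btrib (m + 1) + c * btrib m)"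
    by blast
  define a' b' c' where "a' = a div 8" and "b' = b div 8" and "c' = c div 8"
  have abc': "a = 4 + 8 * a'" "b = 1 + 8 * b'" "c = 1 + 8 * c'"
    using abc unfolding a'_def b'_def c'_def by presburger+
  define D where "D = (\<lambda>m. 4 * btrib (m + 2) + btrib (m + 1) + btrib m)"
  have shift8: "\<exists>e. btrib (m + 2 ^ k) = btrib m + 2 ^ (k - 1) * (D m + 8 * e)" for m
    by (rule exI[of _ "a' * btrib (m + 2) + b' * btrib (m + 1) + c' * btrib m"])
       (simp add: shift D_def abc' algebra_simps)
  have "2 ^ (k - 1) = (8::int) * 2 ^ (k - 4)"
    using assms power_add[of "2::int" 3 "k - 4"] by simp
  then have dvd8: "8 dvd btrib (m + 2 ^ k) - btrib m" for m
    using shift8[of m] by auto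
  have Dper: "8 dvd D (m + 2 ^ k) - D m" for m
  proof -
    have "D (m + 2 ^ k) - D m = 4 * (btrib ((m + 2) + 2 ^ k) - btrib (m + 2))
        + (btrib ((m + 1) + 2 ^ k) - btrib (m + 1)) + (btrib (m + 2 ^ k) - btrib m)"
      by (simp add: D_def algebra_simps)
    then show ?thesis
      by (simp only:) (intro dvd_add dvd_mult dvd8)
  qed
  have Dmult: "8 dvd D (m + s * 2 ^ k) - D m" for s
  proof (induction s)
    case (Suc s)
    have "D (m + Suc s * 2 ^ k) - D m =
        (D ((m + s * 2 ^ k) + 2 ^ k) - D (m + s * 2 ^ k)) + (D (m + s * 2 ^ k) - D m)"
      by (simp add: ac_simps)
    then show ?case
      using Suc Dper by (simp only:) (intro dvd_add)
  qed simp
  have "\<exists>e. btrib (m + s * 2 ^ k) = btrib m + 2 ^ (k - 1) * (int s * D m + 8 * e)"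
  proof (induction s)
    case 0
    show ?case
      by (intro exI[of _ 0]) simp
  next
    case (Suc s)
    then obtain e where e: "btrib (m + s * 2 ^ k) = btrib m + 2 ^ (k - 1) * (int s * D m + 8 * e)"
      by blast
    obtain e' where e': "btrib ((m + s * 2 ^ k) + 2 ^ k) =
        btrib (m + s * 2 ^ k) + 2 ^ (k - 1) * (D (m + s * 2 ^ k) + 8 * e')"
      using shift8 by blast
    obtain f where f: "D (m + s * 2 ^ k) = D m + 8 * f"
      using Dmult[of s] by (metis dvdE diff_eq_eq add.commute)
    have "btrib (m + Suc s * 2 ^ k) = btrib ((m + s * 2 ^ k) + 2 ^ k)"
      by (simp add: ac_simps)
    also have "\<dots> = btrib m + 2 ^ (k - 1) * (int (Suc s) * D m + 8 * (e + e' + f))"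
      unfolding e' e f by (simp add: algebra_simps)
    finally show ?case
      by blast
  qed
  then show ?thesis
    by (simp add: D_def)
qed

lemma dvd_16_btrib_imp_mod:
  assumes "16 dvd btrib m"
  shows "m mod 32 \<in> {0, 13, 16, 17}"
proof -
  have small: "\<forall>m\<in>set [0..<32]. 16 dvd btrib m \<longrightarrow> m \<in> {0, 13, 16, 17}"
    by code_simp
  obtain e where
    "btrib (m mod 32 + (m div 32) * 2 ^ 5) = btrib (m mod 32) + 2 ^ (5 - 1) * e"
    using btrib_add_mult_two_power[OF order_refl, of "m mod 32" "m div 32"] by blast
  then have "btrib m = btrib (m mod 32) + 16 * e"
    by (simp add: mod_mult_div_eq mult.commute)
  then have "16 dvd btrib (m mod 32)"
    using assms by (simp add: dvd_add_left_iff)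
  moreover have "m mod 32 \<in> set [0..<32]"
    by (simp only: set_upt atLeastLessThan_iff) simp
  ultimately show ?thesis
    using small by blast
qed

text \<open>
  In the step from \<open>k\<close> to $k+1$ the index is $m = z + 2^k s$ with a zero \<open>z\<close>, and the value
  there is $2^{k-1} (sD + 8e)$ for some \<open>e\<close>, where \<open>D\<close> is odd for $z = 13, 17$ and 4 times an
  odd number for $z = 0, 16$. So divisibility by $2^{k+2}$ forces \<open>s\<close> to be even, that is,
  \<open>m\<close> is congruent to \<open>z\<close> modulo $2^{k+1}$.
\<close>
lemma dvd_btrib_imp_mod:
  assumes "k \<ge> 5" and "2 ^ (k + 1) dvd btrib m"
  shows "m mod 2 ^ k \<in> {0, 13, 16, 17}"
  using assms
proof (induction k rule: dec_induct)
  case base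
  then have "16 dvd btrib m"
    by (rule dvd_trans[rotated]) simp
  then show ?case
    using dvd_16_btrib_imp_mod by simp
next
  case (step k)
  define z where "z = m mod 2 ^ k"
  define s where "s = m div 2 ^ k"
  have "2 ^ (k + 1) dvd btrib m"
    using step.prems by (rule dvd_trans[rotated]) (simp add: le_imp_power_dvd)
  then have z: "z \<in> {0, 13, 16, 17}"
    using step.IH by (simp add: z_def)
  have m: "m = z + s * 2 ^ k"
    unfolding z_def s_def by (simp only: mod_div_mult_eq)
  define D where "D = 4 * btrib (z + 2) + btrib (z + 1) + btrib z"
  have D: "D \<in> {-132, 3, 4, 5}" and z0: "btrib z = 0"
    using z btrib_values by (auto simp: D_def eval_nat_numeral)
  obtain e where "btrib m = btrib z + 2 ^ (k - 1) * (int s * D + 8 * e)"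
    unfolding m D_def using btrib_add_mult_two_power[OF step.hyps(1)] by blast
  then have "2 ^ (k - 1) * 8 dvd 2 ^ (k - 1) * (int s * D + 8 * e)"
    using step.prems step.hyps z0 power_add[of "2::int" "k - 1" 3] by simp
  then have "8 dvd int s * D + 8 * e"
    by simp
  then have "8 dvd int s * D"
    by (simp add: dvd_add_left_iff)
  then have "even s"
    using D by (elim insertE emptyE; simp) presburger+
  then obtain t where "s = 2 * t"
    by blast
  then have "m = z + t * 2 ^ Suc k"
    by (simp add: m)
  moreover have "z < 2 ^ Suc k"
    by (simp add: z_def less_trans[of _ "2 ^ k"])
  ultimately show ?case
    using z by simp
qed

lemma trib_pos: "n \<ge> 1 \<Longrightarrow> trib n > 0"
  by (induction n rule: trib.induct) auto

text \<open>
  The index $n + 17$ of the shifted sequence exceeds each of the zeros $0, 13, 16, 17$, so it can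
  be congruent to one of them modulo $2^k$ only if it is at least $2^k$.
\<close>
lemma two_power_multiplicity_trib_le:
  assumes "n \<ge> 1"
  shows "2 ^ multiplicity 2 (trib n) \<le> 2 * n + 34"
proof (cases "multiplicity 2 (trib n) < 6")
  case True
  then have "(2::nat) ^ multiplicity 2 (trib n) \<le> 2 ^ 5"
    by (intro power_increasing) auto
  then show ?thesis
    by simp
next
  case False
  define k where "k = multiplicity 2 (trib n) - 1"
  have k: "k \<ge> 5" "multiplicity 2 (trib n) = k + 1"
    using False by (auto simp: k_def)
  have "2 ^ (k + 1) dvd trib n"
    using multiplicity_dvd[of 2 "trib n"] k by simp
  then have "int (2 ^ (k + 1)) dvd int (trib n)"
    by (simp only: int_dvd_int_iff)
  then have "2 ^ (k + 1) dvd btrib (n + 17)"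
    by (simp add: btrib_eq_trib)
  then have "(n + 17) mod 2 ^ k \<in> {0, 13, 16, 17}"
    using dvd_btrib_imp_mod k by blast
  then have "2 ^ k \<le> n + 17"
    using assms by (cases "n + 17 < 2 ^ k") auto
  then show ?thesis
    by (simp add: k)
qed

section \<open>Size of the two sides\<close>

lemma two_power_le_trib_squared:
  assumes "n \<ge> 3"
  shows "2 ^ (n - 1) \<le> (trib n)\<^sup>2"
  using assms
proof (induction n rule: less_induct)
  case (less n)
  consider "n = 3" | "n = 4" | "n \<ge> 5"
    using less.prems by linarith
  then show ?case
  proof cases
    case 3
    define j where "j = n - 3"
    have n: "n = Suc (Suc (Suc j))"
      using 3 by (simp add: j_def)
    have "2 ^ (n - 3) \<le> (trib (Suc j))\<^sup>2"
      using less.IH[of "Suc j"] 3 by (simp add: n)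
    moreover have "2 * trib (Suc j) \<le> trib n"
      by (cases j) (auto simp: n)
    then have "(2 * trib (Suc j))\<^sup>2 \<le> (trib n)\<^sup>2"
      by (rule power_mono) simp
    ultimately show ?thesis
      by (simp add: n power_mult_distrib)
  qed (simp_all add: eval_nat_numeral)
qed

text \<open>
  One squaring makes $2^{n-1}$ a lower bound of a factor, a second one clears the denominator of
  the sum of the exponents, which is an arithmetic progression.
\<close>
lemma two_power_le_prod_trib:
  assumes "n \<ge> 3"
  shows "2 ^ ((r + 1) * (n + r * d)) \<le> (\<Prod>i=0..r. trib (n + i * d)) ^ 4"
proof -
  have "2 * (\<Sum>i=0..r. n + i * d - 1) = (r + 1) * (2 * (n - 1) + r * d)"
  proof -
    have "(\<Sum>i=0..r. n + i * d - 1) = (\<Sum>i=0..r. (n - 1) + i * d)"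
      using assms by (intro sum.cong) auto
    also have "\<dots> = (r + 1) * (n - 1) + (\<Sum>i=0..r. i) * d"
      by (simp add: sum.distrib sum_distrib_right)
    finally show ?thesis
      using gauss_sum_nat[of r] by (simp add: algebra_simps)
  qed
  then have "(r + 1) * (n + r * d) \<le> 2 * (\<Sum>i=0..r. n + i * d - 1)"
    using assms by (simp only:) (intro mult_left_mono, auto)
  then have "(2::nat) ^ ((r + 1) * (n + r * d)) \<le> 2 ^ (2 * (\<Sum>i=0..r. n + i * d - 1))"
    by (intro power_increasing) auto
  also have "\<dots> = (\<Prod>i=0..r. 2 ^ (n + i * d - 1)) ^ 2"
    by (simp only: power_sum mult.commute[of 2] power_mult)
  also have "\<dots> \<le> (\<Prod>i=0..r. (trib (n + i * d))\<^sup>2) ^ 2"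
    using assms by (intro power_mono prod_mono conjI two_power_le_trib_squared) auto
  also have "\<dots> = (\<Prod>i=0..r. trib (n + i * d)) ^ 4"
    by (simp flip: power_mult prod_power_distrib)
  finally show ?thesis .
qed

lemma two_power_dvd_fact: "(2::nat) ^ (m div 2) dvd fact m"
proof (induction m rule: less_induct)
  case (less m)
  show ?case
  proof (cases "m < 2")
    case False
    define j where "j = m - 2"
    have m: "m = Suc (Suc j)"
      using False by (simp add: j_def)
    have "even (Suc (Suc j) * Suc j)"
      by simp
    then have "(2::nat) * 2 ^ (j div 2) dvd (Suc (Suc j) * Suc j) * fact j"
      using less[of j] by (intro mult_dvd_mono) (auto simp: m)
    then show ?thesis
      by (simp add: m algebra_simps)
  qed auto
qed

lemma le_multiplicity_fact:
  fixes m :: nat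
  assumes "m \<ge> 2"
  shows "m \<le> 3 * multiplicity 2 (fact m :: nat)"
proof -
  have "m div 2 \<le> multiplicity 2 (fact m :: nat)"
    by (rule multiplicity_geI) (auto simp: two_power_dvd_fact)
  then show ?thesis
    using assms by linarith
qed

text \<open>
  Each $m$ is at most $3 v_2(m!) \le 3V \le Q$. Hence $m! \le m^m \le Q^{3 v_2(m!)}$, and the
  exponents add up to $3V$.
\<close>
lemma prod_fact_le:
  fixes f :: "nat \<Rightarrow> nat"
  assumes "\<And>j. j < k \<Longrightarrow> f j \<ge> 2"
    and V: "V = multiplicity 2 (\<Prod>j<k. fact (f j) :: nat)"
    and "3 * V \<le> Q" and "Q \<ge> 1"
  shows "(\<Prod>j<k. fact (f j)) \<le> Q ^ (3 * V)" "k \<le> V" "\<And>j. j < k \<Longrightarrow> f j \<le> Q"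
proof -
  define v where "v = (\<lambda>j. multiplicity 2 (fact (f j) :: nat))"
  have V_sum: "V = (\<Sum>j<k. v j)"
    unfolding V v_def by (rule prime_elem_multiplicity_prod_distrib) auto
  have fv: "f j \<le> 3 * v j" if "j < k" for j
    using le_multiplicity_fact[OF assms(1)[OF that]] by (simp add: v_def)
  have vV: "v j \<le> V" if "j < k" for j
    unfolding V_sum using that by (intro member_le_sum) auto
  show fQ: "f j \<le> Q" if "j < k" for j
    using fv[OF that] vV[OF that] assms(3) by linarith
  have "v j \<ge> 1" if "j < k" for j
    using fv[OF that] assms(1)[OF that] by linarith
  then have "(\<Sum>j<k. 1) \<le> V"
    unfolding V_sum by (intro sum_mono) auto
  then show "k \<le> V"
    by simp
  have "fact (f j) \<le> Q ^ (3 * v j)" if "j < k" for j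
  proof -
    have "fact (f j) \<le> f j ^ f j"
      using fact_le_power[of "f j", where ?'a = nat] by simp
    also have "\<dots> \<le> Q ^ f j"
      using fQ[OF that] by (rule power_mono) simp
    also have "\<dots> \<le> Q ^ (3 * v j)"
      using fv[OF that] assms(4) by (rule power_increasing)
    finally show ?thesis .
  qed
  then have "(\<Prod>j<k. fact (f j)) \<le> (\<Prod>j<k. Q ^ (3 * v j))"
    by (intro prod_mono) auto
  also have "\<dots> = Q ^ (3 * V)"
    by (simp add: V_sum power_sum sum_distrib_left)
  finally show "(\<Prod>j<k. fact (f j)) \<le> Q ^ (3 * V)" .
qed

section \<open>Bounding the solutions\<close>

lemma multiplicity_prod_trib_le:
  assumes "n \<ge> 1" and "2 * (n + r * d) + 34 < 2 ^ (B + 1)"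
  shows "multiplicity 2 (\<Prod>i=0..r. trib (n + i * d)) \<le> (r + 1) * B"
proof -
  have pos: "trib (n + i * d) > 0" for i
    using assms(1) by (intro trib_pos) simp
  have nonzero: "0 \<notin> (\<lambda>i. trib (n + i * d)) ` {0..r}"
  proof
    assume "0 \<in> (\<lambda>i. trib (n + i * d)) ` {0..r}"
    then obtain i where "0 = trib (n + i * d)"
      by (rule imageE)
    with pos[of i] show False
      by simp
  qed
  have "multiplicity 2 (trib (n + i * d)) \<le> B" if "i \<le> r" for i
  proof -
    have "2 ^ multiplicity 2 (trib (n + i * d)) \<le> 2 * (n + i * d) + 34"
      using assms by (intro two_power_multiplicity_trib_le) auto
    also have "\<dots> \<le> 2 * (n + r * d) + 34"
      using that by simp
    also have "\<dots> < 2 ^ (B + 1)"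
      by (rule assms)
    finally have "multiplicity 2 (trib (n + i * d)) < B + 1"
      by (rule power_less_imp_less_exp[rotated]) simp
    then show ?thesis
      by simp
  qed
  then have "(\<Sum>i=0..r. multiplicity 2 (trib (n + i * d))) \<le> (\<Sum>i=0..r. B)"
    by (intro sum_mono) auto
  moreover have "multiplicity 2 (\<Prod>i=0..r. trib (n + i * d)) =
      (\<Sum>i=0..r. multiplicity 2 (trib (n + i * d)))"
    using nonzero by (intro prime_elem_multiplicity_prod_distrib) simp_all
  ultimately show ?thesis
    by simp
qed

lemma trib_fact_solution_bounds:
  assumes sol: "trib_fact_solution n r d k ms" and B: "2 * (n + r * d) + 34 < 2 ^ (B + 1)"
  shows "2 ^ (n + r * d) \<le> (3 * ((r + 1) * B)) ^ (12 * B)" (is "2 ^ ?N \<le> ?Q ^ _")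
    and "k \<le> (r + 1) * B" and "set ms \<subseteq> {..3 * ((r + 1) * B)}"
proof -
  note sol = sol[unfolded trib_fact_solution_def]
  define V where "V = multiplicity 2 (\<Prod>j<k. fact (ms ! j) :: nat)"
  have V: "V \<le> (r + 1) * B"
    using multiplicity_prod_trib_le[OF _ B] sol by (simp add: V_def)
  have "B \<noteq> 0"
    using B by (intro notI) simp
  then have Q: "3 * V \<le> ?Q" "?Q \<ge> 1"
    using V by simp_all
  have ms: "2 \<le> ms ! j" if "j < k" for j
    using sol that by auto
  note bounds = prod_fact_le[where f = "\<lambda>j. ms ! j", OF ms V_def Q]
  show "k \<le> (r + 1) * B"
    using bounds(2) V by simp
  show "set ms \<subseteq> {..?Q}"
    using bounds(3) sol by (auto simp: in_set_conv_nth)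
  have "(2 ^ ?N) ^ (r + 1) = (2::nat) ^ ((r + 1) * ?N)"
    by (subst power_mult[symmetric]) (simp only: mult.commute)
  also have "\<dots> \<le> (\<Prod>i=0..r. trib (n + i * d)) ^ 4"
    using sol by (intro two_power_le_prod_trib) simp
  also have "\<dots> = (\<Prod>j<k. fact (ms ! j)) ^ 4"
    using sol by simp
  also have "\<dots> \<le> (?Q ^ (3 * V)) ^ 4"
    by (rule power_mono[OF bounds(1)]) simp_all
  also have "\<dots> = ?Q ^ (12 * V)"
    by (simp flip: power_mult add: mult.commute)
  also have "\<dots> \<le> ?Q ^ (12 * ((r + 1) * B))"
    using V Q(2) by (intro power_increasing) auto
  also have "\<dots> = (?Q ^ (12 * B)) ^ (r + 1)"
    by (simp only: power_mult[symmetric] ac_simps)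
  finally show "2 ^ ?N \<le> ?Q ^ (12 * B)"
    by (subst (asm) power_mono_iff) simp_all
qed

lemma quadratic_less_two_power:
  assumes "e \<ge> 13"
  shows "12 * (e + 2) * (2 * e + 1) < (2::nat) ^ e"
  using assms
proof (induction e rule: dec_induct)
  case (step e)
  have "4 * e + 7 \<le> e * e"
    using mult_le_mono1[OF step.hyps(1), of e] step.hyps(1) by linarith
  then have "12 * (Suc e + 2) * (2 * Suc e + 1) \<le> 2 * (12 * (e + 2) * (2 * e + 1))"
    by (simp add: algebra_simps)
  then show ?case
    using step.IH by simp
qed simp

text \<open>
  With $2^e \le N < 2^{e+1}$ one can take $B = e + 2$ in the bounds above, and then the base
  there is at most $2^{2e+1}$. This gives $2^e \le N \le 12 (e+2) (2e+1)$, which fails from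
  $e = 13$ on.
\<close>
lemma trib_fact_solution_less:
  assumes sol: "trib_fact_solution n r d k ms"
  shows "n + r * d < 8192"
proof (rule ccontr)
  define N where "N = n + r * d"
  assume "\<not> n + r * d < 8192"
  then have N: "N \<ge> 2 ^ 13"
    by (simp add: N_def)
  obtain e where e: "2 ^ e \<le> N" "N < 2 ^ (e + 1)"
    using ex_power_ivl1[of 2 N] N by auto
  have "(2::nat) ^ 13 < 2 ^ (e + 1)"
    using N e(2) by (rule le_less_trans)
  then have "13 < e + 1"
    by (subst (asm) power_strict_increasing_iff) auto
  then have e13: "e \<ge> 13"
    by simp
  have "(34::nat) < 2 ^ e"
    using power_increasing[OF e13, of "2::nat"] by simp
  then have "2 * N + 34 < 2 ^ ((e + 2) + 1)"
    using e by simp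
  from trib_fact_solution_bounds(1)[OF sol this[unfolded N_def]]
  have *: "2 ^ N \<le> (3 * ((r + 1) * (e + 2))) ^ (12 * (e + 2))"
    by (simp only: N_def)
  have "d \<ge> 1" "n \<ge> 1"
    using sol by (auto simp: trib_fact_solution_def)
  then have "r + 1 \<le> N"
    unfolding N_def by (metis add.commute add_mono mult.right_neutral mult_le_mono2)
  then have "r + 1 \<le> 2 ^ (e + 1)"
    using e by simp
  moreover have "3 * (e + 2) \<le> 12 * (e + 2) * (2 * e + 1)"
    by simp
  then have "3 * (e + 2) \<le> 2 ^ e"
    using quadratic_less_two_power[OF e13] by linarith
  ultimately have "(r + 1) * (3 * (e + 2)) \<le> 2 ^ (e + 1) * 2 ^ e"
    by (rule mult_le_mono)
  moreover have "(2::nat) ^ (e + 1) * 2 ^ e = 2 ^ (2 * e + 1)"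
    by (simp add: mult_2 distrib_right flip: power_add)
  ultimately have "3 * ((r + 1) * (e + 2)) \<le> 2 ^ (2 * e + 1)"
    by (simp only: mult.left_commute[of 3])
  then have "(3 * ((r + 1) * (e + 2))) ^ (12 * (e + 2)) \<le> (2 ^ (2 * e + 1)) ^ (12 * (e + 2))"
    by (rule power_mono) simp
  also have "\<dots> = (2::nat) ^ (12 * (e + 2) * (2 * e + 1))"
    by (simp only: power_mult[symmetric] mult.commute)
  finally have "(2::nat) ^ N \<le> 2 ^ (12 * (e + 2) * (2 * e + 1))"
    using * by (rule le_trans[rotated])
  then have "N \<le> 12 * (e + 2) * (2 * e + 1)"
    by (subst (asm) power_increasing_iff) auto
  then show False
    using quadratic_less_two_power[OF e13] e by linarith
qed

theorem theorem2p3: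
  "finite {(n, r, d, k, ms). trib_fact_solution n r d k ms} \<and>
   (\<forall>n r d k ms. trib_fact_solution n r d k ms \<longrightarrow> r * d \<le> 1439862 \<and> n < 719933)"
proof
  show "\<forall>n r d k ms. trib_fact_solution n r d k ms \<longrightarrow> r * d \<le> 1439862 \<and> n < 719933"
    using trib_fact_solution_less by fastforce
  \<comment> \<open>the bound on the $m_j$ for $r + 1 = 8192$ and $B = 15$; the other bounds are smaller\<close>
  define K :: nat where "K = 3 * (8192 * 15)"
  have "trib_fact_solution n r d k ms \<Longrightarrow>
      (n, r, d, k, ms) \<in> {..K} \<times> {..K} \<times> {..K} \<times> {..K} \<times> {ms. set ms \<subseteq> {..K} \<and> length ms \<le> K}"
    for n r d k ms
  proof -
    assume sol: "trib_fact_solution n r d k ms"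
    then have less: "n + r * d < 8192"
      by (rule trib_fact_solution_less)
    then have "2 * (n + r * d) + 34 < 2 ^ (15 + 1)"
      by simp
    note bounds = trib_fact_solution_bounds(2,3)[OF sol this]
    have *: "r \<ge> 1" "d \<ge> 1" "length ms = k"
      using sol by (auto simp: trib_fact_solution_def)
    then have "r \<le> r * d" "d \<le> r * d"
      by simp_all
    then have nrd: "n < 8192" "r < 8192" "d < 8192"
      using less by linarith+
    then have "3 * ((r + 1) * 15) \<le> K"
      by (simp add: K_def)
    then have "k \<le> K" "set ms \<subseteq> {..K}"
      using bounds by auto
    then show ?thesis
      using nrd * by (auto simp: K_def)
  qed
  then have "{(n, r, d, k, ms). trib_fact_solution n r d k ms} \<subseteq>
      {..K} \<times> {..K} \<times> {..K} \<times> {..K} \<times> {ms. set ms \<subseteq> {..K} \<and> length ms \<le> K}"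
    by blast
  moreover have "finite \<dots>"
    by (intro finite_cartesian_product finite_lists_length_le finite_atMost)
  ultimately show "finite {(n, r, d, k, ms). trib_fact_solution n r d k ms}"
    by (rule finite_subset)
qed

end
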